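(* Let $n\ge 2$ be an integer, let $u>0$, and let $\hat{\mathsf w}=(\hat x,\hat y,\hat z)\in\mathbb{R}^{n-2}\times\mathbb{R}\times\mathbb{R}$. Let $\mathcal P$ be the capped rotated second-order cone, and let $\tilde x$, $M$ and $P_C$ be as defined in the context. Then the Euclidean projection $(x^*,y^*,z^* )=P_{\mathcal P}(\hat{\mathsf w})$ of $\hat{\mathsf w}$ onto $\mathcal P$ is given by $$ (x^*,y^*,z^* )=\begin{cases} (\hat x,\hat y,u), & \text{if } \|\hat x\|^2<2u\hat y \text{ and } u\le \hat z,\\[4pt] \left(\tilde x,\frac{\|\tilde x\|^2}{2u},u\right), & \text{if } \hat z\ge u-\frac{\tilde x}{u}\cdot(\hat x-\tilde x)-\frac{\|\tilde x\|^2}{2u^2}\left(\hat y-\frac{\|\tilde x\|^2}{2u}\right),\ \|\tilde x\|\le\|\hat x\| \text{ and } \hat y\le\frac{\|\tilde x\|^2}{2u},\\[4pt] M P_C(M\hat{\mathsf w}), & \text{otherwise.} \end{cases} $$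
   Context: Vectors $\mathsf w\in\mathbb{R}^n$ are written $\mathsf w=(x,y,z)$ with $x=(w_1,\dots,w_{n-2})\in\mathbb{R}^{n-2}$, $y=w_{n-1}$, $z=w_n$. $\|\cdot\|$ is the Euclidean norm and $\cdot$ the dot product. For a nonempty closed convex set $S\subseteq\mathbb{R}^n$, $P_S(\mathsf w)$ denotes the Euclidean projection of $\mathsf w$ onto $S$, i.e. the unique minimizer of $\|\mathsf v-\mathsf w\|$ over $\mathsf v\in S$. The rotated second-order cone is $C_r=\{(x,y,z)\in\mathbb{R}^{n-2}\times\mathbb{R}_+\times\mathbb{R}_+ : \|x\|^2\le 2yz\}$, and for $u>0$ the capped rotated second-order cone is $\mathcal P=\{(x,y,z)\in C_r : z\le u\}$. The standard second-order cone is $C=\{w\in\mathbb{R}^n : \|w_{1:n-1}\|\le w_n\}$, where $w_{1:n-1}=(w_1,\dots,w_{n-1})$. Its projection is given by $P_C(w)=w$ if $\|w_{1:n-1}\|\le w_n$, $P_C(w)=0$ if $\|w_{1:n-1}\|\le -w_n$, and $P_C(w)=\frac{\|w_{1:n-1}\|+w_n}{2}\left(\frac{w_{1:n-1}}{\|w_{1:n-1}\|},1\right)$ otherwise. The $n\times n$ matrix $M$ is $$M=\begin{pmatrix} I_{n-2}&0&0\\ 0&-\frac1{\sqrt2}&\frac1{\sqrt2}\\ 0&\frac1{\sqrt2}&\frac1{\sqrt2}\end{pmatrix}.$$ Given $(\hat x,\hat y,\hat z)$ and $u$, define $$\tilde x=\frac{2u^2}{\alpha^2-2u\hat y+2u^2}\,\hat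 x,$$ where $\alpha$ is the solution of the cubic equation $t^3+(-2u\hat y+2u^2)t-2u^2\|\hat x\|=0$ given by $$\alpha=\frac{\sqrt{2u}}{6}A^{1/3}+\sqrt{2u}\,(-2u+2\hat y)\,A^{-1/3},\qquad A=54\sqrt{2u}\,\|\hat x\|+6\sqrt{162\|\hat x\|^2u-48\hat y^3+144\hat y^2u-144\hat yu^2+48u^3}.$$ *)

theory Defs
  imports "HOL-Analysis.Analysis"
begin

text \<open>
  The space of dimension \<open>n\<close> is \<open>real ^ 'n\<close> over a finite linearly ordered index type, with
  \<open>n = CARD('n)\<close>, so that the coordinates can be listed in order. The coordinate
  \<open>y\<close> is the last but one, \<open>z\<close> the last; they are distinct as soon as \<open>CARD('n) \<ge> 2\<close>.
\<close>

definition z_ix :: "'n::{finite,linorder}" where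
  "z_ix = Max UNIV"

definition y_ix :: "'n::{finite,linorder}" where
  "y_ix = Max (UNIV - {z_ix})"

text \<open>
  There is no type \<open>real ^ (n - 2)\<close> that also covers \<open>n = 2\<close>. The subvectors consisting of the
  first \<open>n - 2\<close> and of the first \<open>n - 1\<close> coordinates are therefore embedded in \<open>real ^ 'n\<close> by
  padding with zeros, which changes neither norms nor inner products.
\<close>

definition x_part :: "real ^ 'n::{finite,linorder} \<Rightarrow> real ^ 'n::{finite,linorder}" where
  "x_part w = (\<chi> i. if i = y_ix \<or> i = z_ix then 0 else w $ i)"

definition init_part :: "real ^ 'n::{finite,linorder} \<Rightarrow> real ^ 'n::{finite,linorder}" where
  "init_part w = (\<chi> i. if i = z_ix then 0 else w $ i)"

text \<open>The vector \<open>(x, y, z)\<close>; the last two coordinates of the padded vector \<open>x\<close> are ignored.\<close>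

definition triple :: "real ^ 'n::{finite,linorder} \<Rightarrow> real \<Rightarrow> real \<Rightarrow> real ^ 'n::{finite,linorder}" where
  "triple x y z = (\<chi> i. if i = z_ix then z else if i = y_ix then y else x $ i)"

definition rsoc :: "(real ^ 'n::{finite,linorder}) set" where
  "rsoc = {w. 0 \<le> w $ y_ix \<and> 0 \<le> w $ z_ix \<and> (norm (x_part w))\<^sup>2 \<le> 2 * w $ y_ix * w $ z_ix}"

definition capped_rsoc :: "real \<Rightarrow> (real ^ 'n::{finite,linorder}) set" where
  "capped_rsoc u = {w \<in> rsoc. w $ z_ix \<le> u}"

definition soc :: "(real ^ 'n::{finite,linorder}) set" where
  "soc = {w. norm (init_part w) \<le> w $ z_ix}"

text \<open>Closed form of the Euclidean projection onto \<open>soc\<close>; see \<open>proj_soc_eq_closest_point\<close>.\<close>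

definition proj_soc :: "real ^ 'n::{finite,linorder} \<Rightarrow> real ^ 'n::{finite,linorder}" where
  "proj_soc w =
     (if norm (init_part w) \<le> w $ z_ix then w
      else if norm (init_part w) \<le> - w $ z_ix then 0
      else ((norm (init_part w) + w $ z_ix) / 2) *\<^sub>R
             (init_part w /\<^sub>R norm (init_part w) + axis z_ix 1))"

definition rot_matrix :: "real ^ 'n::{finite,linorder} ^ 'n::{finite,linorder}" where
  "rot_matrix = (\<chi> i j.
     if i = z_ix \<and> j = z_ix then 1 / sqrt 2
     else if i = y_ix \<and> j = y_ix then - 1 / sqrt 2
     else if i = y_ix \<and> j = z_ix \<or> i = z_ix \<and> j = y_ix then 1 / sqrt 2
     else if i = j then 1 else 0)"

text \<open>
  Cardano's formula. The radicand may be negative (three real roots of the cubic), so the square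
  root and the cube roots are the principal complex ones. The resulting root is always real
  (\<open>of_real_alpha\<close>). If \<open>x = 0\<close> and \<open>y = u\<close> then \<open>cardano_A u x y = 0\<close>, and its negative power is
  \<open>0\<close> here; its coefficient vanishes as well.
\<close>

definition cardano_A :: "real \<Rightarrow> 'a::real_normed_vector \<Rightarrow> real \<Rightarrow> complex" where
  "cardano_A u x y =
     of_real (54 * sqrt (2 * u) * norm x) +
     6 * csqrt (of_real (162 * (norm x)\<^sup>2 * u - 48 * y ^ 3 + 144 * y\<^sup>2 * u
                         - 144 * y * u\<^sup>2 + 48 * u ^ 3))"

definition alpha_complex :: "real \<Rightarrow> 'a::real_normed_vector \<Rightarrow> real \<Rightarrow> complex" where
  "alpha_complex u x y =
     of_real (sqrt (2 * u) / 6) * cardano_A u x y powr (1 / 3) +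
     of_real (sqrt (2 * u) * (- 2 * u + 2 * y)) * cardano_A u x y powr (- 1 / 3)"

definition alpha :: "real \<Rightarrow> 'a::real_normed_vector \<Rightarrow> real \<Rightarrow> real" where
  "alpha u x y = Re (alpha_complex u x y)"

text \<open>
  By \<open>alpha_complex_cubic\<close> the denominator is nonzero unless \<open>x = 0\<close> and \<open>u \<le> y\<close>; the value is
  then \<open>0\<close>, as it would be for any value of the quotient.
\<close>

definition x_tilde :: "real \<Rightarrow> 'a::real_normed_vector \<Rightarrow> real \<Rightarrow> 'a" where
  "x_tilde u x y = (2 * u\<^sup>2 / ((alpha u x y)\<^sup>2 - 2 * u * y + 2 * u\<^sup>2)) *\<^sub>R x"

lemma y_ix_neq_z_ix:
  assumes "CARD('n::{finite,linorder}) \<ge> 2"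
  shows "(y_ix :: 'n) \<noteq> z_ix"
proof -
  have "UNIV - {z_ix :: 'n} \<noteq> {}"
  proof
    assume "UNIV - {z_ix :: 'n} = {}"
    then have "UNIV = {z_ix :: 'n}" by blast
    then have "CARD('n) = 1" by (metis is_singletonI is_singleton_altdef)
    then show False using assms by simp
  qed
  then have "(y_ix :: 'n) \<in> UNIV - {z_ix}" unfolding y_ix_def by (intro Max_in) auto
  then show ?thesis by simp
qed

lemma init_part_plus_axis: "init_part w + w $ z_ix *\<^sub>R axis z_ix 1 = w"
  by (simp add: vec_eq_iff init_part_def axis_def)

lemma inner_init_axis: "init_part w \<bullet> axis z_ix r = 0"
  by (simp add: inner_axis init_part_def)

lemma inner_split_last: "v \<bullet> w = init_part v \<bullet> init_part w + v $ z_ix * w $ z_ix"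
proof -
  have "v \<bullet> w = (init_part v + v $ z_ix *\<^sub>R axis z_ix 1) \<bullet> (init_part w + w $ z_ix *\<^sub>R axis z_ix 1)"
    by (simp add: init_part_plus_axis)
  also have "\<dots> = init_part v \<bullet> init_part w + v $ z_ix * w $ z_ix"
    by (simp add: inner_add_left inner_add_right inner_init_axis inner_axis_axis
        inner_commute[of "axis _ _" "init_part _"])
  finally show ?thesis .
qed

lemma init_part_linear:
  "init_part (v + w) = init_part v + init_part w"
  "init_part (v - w) = init_part v - init_part w"
  "init_part (c *\<^sub>R w) = c *\<^sub>R init_part w"
  by (simp_all add: vec_eq_iff init_part_def)

lemma x_part_linear:
  "x_part (v + w) = x_part v + x_part w"
  "x_part (v - w) = x_part v - x_part w"
  "x_part (c *\<^sub>R w) = c *\<^sub>R x_part w"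
  by (simp_all add: vec_eq_iff x_part_def)

lemma linear_init_part: "linear init_part"
  by (rule linearI) (simp_all add: init_part_linear)

lemma linear_x_part: "linear x_part"
  by (rule linearI) (simp_all add: x_part_linear)

lemma closed_soc: "closed soc"
  unfolding soc_def
  by (intro closed_Collect_le continuous_intros linear_continuous_on
      linear_conv_bounded_linear[THEN iffD1] linear_init_part)

lemma convex_soc: "convex (soc :: (real ^ 'n::{finite,linorder}) set)"
proof (rule convexI)
  fix v w :: "(real, 'n) vec" and a b :: real
  assume vw: "v \<in> soc" "w \<in> soc" and ab: "0 \<le> a" "0 \<le> b" "a + b = 1"
  have "norm (init_part (a *\<^sub>R v + b *\<^sub>R w)) \<le> a * norm (init_part v) + b * norm (init_part w)"
    using ab norm_triangle_ineq[of "a *\<^sub>R init_part v" "b *\<^sub>R init_part w"]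
    by (simp add: init_part_linear)
  also have "\<dots> \<le> a * v $ z_ix + b * w $ z_ix"
    using vw ab by (intro add_mono mult_left_mono) (auto simp: soc_def)
  finally show "a *\<^sub>R v + b *\<^sub>R w \<in> soc" by (simp add: soc_def)
qed

lemma proj_soc_eq_closest_point:
  fixes w :: "real ^ 'n::{finite,linorder}"
  shows "proj_soc w = closest_point soc w"
proof -
  define p where "p = init_part w"
  define t where "t = w $ z_ix"
  have key: "proj_soc w \<in> soc \<and> (\<forall>v\<in>soc. (w - proj_soc w) \<bullet> (v - proj_soc w) \<le> 0)"
  proof (cases "norm p \<le> t")
    case True
    then show ?thesis by (simp add: proj_soc_def soc_def p_def t_def)
  next
    case 1: False
    show ?thesis
    proof (cases "norm p \<le> - t")
      case True
      have P: "proj_soc w = 0" using 1 True by (simp add: proj_soc_def p_def t_def)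
      have "init_part (0::(real, 'n) vec) = 0" by (simp add: vec_eq_iff init_part_def)
      moreover have "w \<bullet> v \<le> 0" if "v \<in> soc" for v
      proof -
        have v: "norm (init_part v) \<le> v $ z_ix" using that by (simp add: soc_def)
        have v0: "0 \<le> v $ z_ix" using v norm_ge_zero order_trans by blast
        have "w \<bullet> v \<le> norm p * norm (init_part v) + t * v $ z_ix"
          unfolding inner_split_last[of w v] p_def t_def
          using norm_cauchy_schwarz[of "init_part w" "init_part v"] by simp
        also have "\<dots> \<le> norm p * v $ z_ix + t * v $ z_ix"
          using v by (intro add_right_mono mult_left_mono) auto
        also have "\<dots> = (norm p + t) * v $ z_ix" by (simp add: algebra_simps)
        also have "\<dots> \<le> 0" using True v0 by (intro mult_nonpos_nonneg) auto
        finally show ?thesis .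
      qed
      ultimately show ?thesis by (simp add: P soc_def)
    next
      case 2: False
      define r where "r = norm p"
      define k where "k = (r + t) / 2"
      have r: "r > 0" using 1 2 unfolding r_def by linarith
      have k: "k > 0" using 2 by (simp add: k_def r_def)
      have rk: "r > k" using 1 by (simp add: k_def r_def)
      have P: "proj_soc w = k *\<^sub>R (p /\<^sub>R r + axis z_ix 1)"
        using 1 2 by (simp add: proj_soc_def p_def t_def k_def r_def)
      have ia: "init_part (axis z_ix 1 :: (real, 'n) vec) = 0" "init_part p = p" "p $ z_ix = 0"
        by (auto simp: vec_eq_iff init_part_def axis_def p_def)
      have IP: "init_part (proj_soc w) = (k / r) *\<^sub>R p"
        by (simp add: P init_part_linear ia divide_inverse)
      have ZP: "proj_soc w $ z_ix = k" by (simp add: P ia axis_def)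
      have NP: "norm (init_part (proj_soc w)) = k" using r k by (simp add: IP r_def)
      have pp: "p \<bullet> p = r * r" by (simp add: r_def dot_square_norm power2_eq_square)
      have "(w - proj_soc w) \<bullet> (v - proj_soc w) \<le> 0" if "v \<in> soc" for v
      proof -
        have v: "norm (init_part v) \<le> v $ z_ix" using that by (simp add: soc_def)
        have tk: "t - k = k - r" by (simp add: k_def field_simps)
        have A: "init_part (w - proj_soc w) = (1 - k / r) *\<^sub>R p"
          by (simp add: init_part_linear IP p_def[symmetric] scaleR_diff_left)
        have "(w - proj_soc w) \<bullet> (v - proj_soc w)
            = (1 - k / r) * (p \<bullet> init_part v - (k / r) * (r * r)) + (t - k) * (v $ z_ix - k)"
          unfolding inner_split_last[of "w - _"] A
          unfolding init_part_linear IP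
          by (simp only: inner_scaleR_left inner_scaleR_right inner_diff_right pp
              vector_minus_component ZP t_def) (simp only: right_diff_distrib mult.left_commute)
        also have "\<dots> = (1 - k / r) * (p \<bullet> init_part v - r * v $ z_ix)"
        proof -
          have "k - r = - r * (1 - k / r)" "(k / r) * (r * r) = k * r" using r by (simp_all add: field_simps)
          then show ?thesis unfolding tk using r by (simp add: ring_distribs)
        qed
        also have "\<dots> \<le> 0"
        proof (rule mult_nonneg_nonpos)
          show "0 \<le> 1 - k / r" using r rk by simp
          have "p \<bullet> init_part v \<le> r * norm (init_part v)"
            unfolding r_def by (rule norm_cauchy_schwarz)
          also have "\<dots> \<le> r * v $ z_ix" using v r by (intro mult_left_mono) auto
          finally show "p \<bullet> init_part v - r * v $ z_ix \<le> 0" by simp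
        qed
        finally show ?thesis .
      qed
      then show ?thesis by (simp add: soc_def NP ZP)
    qed
  qed
  have "dist w (proj_soc w) \<le> dist w v" if "v \<in> soc" for v
  proof -
    define a b where "a = w - proj_soc w" and "b = v - proj_soc w"
    have "a \<bullet> b \<le> 0" using key that by (simp add: a_def b_def)
    then have "a \<bullet> a \<le> (a - b) \<bullet> (a - b)"
      using inner_ge_zero[of b]
      unfolding inner_diff_left inner_diff_right inner_commute[of b a] by linarith
    then have "norm a \<le> norm (a - b)" by (simp add: norm_le)
    then show ?thesis by (simp add: a_def b_def dist_norm)
  qed
  then show ?thesis
    by (intro closest_point_unique convex_soc closed_soc) (use key in auto)
qed

lemma closed_capped_rsoc: "closed (capped_rsoc u :: (real ^ 'n::{finite,linorder}) set)"
proof -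
  have "capped_rsoc u = {w. 0 \<le> w $ y_ix} \<inter> {w. 0 \<le> w $ z_ix} \<inter>
      {w :: (real, 'n) vec. (norm (x_part w))\<^sup>2 \<le> 2 * w $ y_ix * w $ z_ix} \<inter> {w. w $ z_ix \<le> u}"
    by (auto simp: capped_rsoc_def rsoc_def)
  also have "closed \<dots>"
    by (intro closed_Int closed_Collect_le continuous_intros linear_continuous_on
        linear_conv_bounded_linear[THEN iffD1] linear_x_part)
  finally show ?thesis .
qed

lemma convex_capped_rsoc: "convex (capped_rsoc u :: (real ^ 'n::{finite,linorder}) set)"
proof (rule convexI)
  fix v w :: "(real, 'n) vec" and a b :: real
  assume v: "v \<in> capped_rsoc u" and w: "w \<in> capped_rsoc u"
    and ab: "0 \<le> a" "0 \<le> b" "a + b = 1"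
  define p q y1 z1 y2 z2 where "p = norm (x_part v)" and "q = norm (x_part w)"
    and "y1 = v $ y_ix" and "z1 = v $ z_ix" and "y2 = w $ y_ix" and "z2 = w $ z_ix"
  note d = p_def q_def y1_def z1_def y2_def z2_def
  have pos: "0 \<le> y1" "0 \<le> z1" "0 \<le> y2" "0 \<le> z2" "0 \<le> p" "0 \<le> q"
    and c1: "p\<^sup>2 \<le> 2 * y1 * z1" and c2: "q\<^sup>2 \<le> 2 * y2 * z2" and cap: "z1 \<le> u" "z2 \<le> u"
    using v w by (auto simp: capped_rsoc_def rsoc_def d)
  have "(p * q)\<^sup>2 \<le> (2 * y1 * z1) * (2 * y2 * z2)"
    unfolding power_mult_distrib[of p q] by (rule mult_mono[OF c1 c2]) (use pos in simp_all)
  also have "\<dots> \<le> (y1 * z2 + y2 * z1)\<^sup>2"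
    using zero_le_power2[of "y1 * z2 - y2 * z1"] by (simp add: power2_eq_square algebra_simps)
  finally have pq: "p * q \<le> y1 * z2 + y2 * z1" using pos by - (rule power2_le_imp_le, simp_all add: add_nonneg_nonneg)
  have "norm (x_part (a *\<^sub>R v + b *\<^sub>R w)) \<le> a * p + b * q"
    using ab norm_triangle_ineq[of "a *\<^sub>R x_part v" "b *\<^sub>R x_part w"]
    by (simp add: x_part_linear d)
  then have "(norm (x_part (a *\<^sub>R v + b *\<^sub>R w)))\<^sup>2 \<le> (a * p + b * q)\<^sup>2"
    by (intro power_mono) auto
  also have "\<dots> = a\<^sup>2 * p\<^sup>2 + b\<^sup>2 * q\<^sup>2 + 2 * (a * b) * (p * q)"
    by (simp add: power2_eq_square algebra_simps)
  also have "\<dots> \<le> a\<^sup>2 * (2 * y1 * z1) + b\<^sup>2 * (2 * y2 * z2) + 2 * (a * b) * (y1 * z2 + y2 * z1)"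
    using c1 c2 pq ab by (intro add_mono mult_left_mono) auto
  also have "\<dots> = 2 * (a * y1 + b * y2) * (a * z1 + b * z2)"
    by (simp add: power2_eq_square algebra_simps)
  finally have "(norm (x_part (a *\<^sub>R v + b *\<^sub>R w)))\<^sup>2 \<le> 2 * (a * y1 + b * y2) * (a * z1 + b * z2)" .
  moreover have "a * z1 + b * z2 \<le> u"
    using cap ab by (metis convex_bound_le)
  ultimately show "a *\<^sub>R v + b *\<^sub>R w \<in> capped_rsoc u"
    using pos ab by (simp add: capped_rsoc_def rsoc_def d)
qed

lemma capped_rsoc_nonempty:
  assumes "u > 0"
  shows "(capped_rsoc u :: (real ^ 'n::{finite,linorder}) set) \<noteq> {}"
proof -
  have "x_part (0 :: (real, 'n) vec) = 0" by (simp add: vec_eq_iff x_part_def)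
  then have "(0 :: (real, 'n) vec) \<in> capped_rsoc u" using assms by (simp add: capped_rsoc_def rsoc_def)
  then show ?thesis by blast
qed

lemma cardano_A_square:
  assumes "u > 0"
  shows "(cardano_A u x y)\<^sup>2 =
    of_real (108 * sqrt (2 * u) * norm x) * cardano_A u x y + of_real (1728 * (u - y) ^ 3)"
proof -
  define A where "A = cardano_A u x y"
  define B where "B = 54 * sqrt (2 * u) * norm x"
  define D where "D = 162 * (norm x)\<^sup>2 * u - 48 * y ^ 3 + 144 * y\<^sup>2 * u - 144 * y * u\<^sup>2 + 48 * u ^ 3"
  have "A - of_real B = 6 * csqrt (of_real D)"
    by (simp add: A_def B_def D_def cardano_A_def)
  then have "(A - of_real B)\<^sup>2 = of_real (36 * D)" by (simp add: power_mult_distrib)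
  then have "A\<^sup>2 = of_real (2 * B) * A + of_real (36 * D - B\<^sup>2)"
    by (simp add: power2_eq_square algebra_simps)
  moreover have "36 * D - B\<^sup>2 = 1728 * (u - y) ^ 3"
    using assms by (simp add: B_def D_def power_mult_distrib power2_eq_square power3_eq_cube algebra_simps)
  ultimately have "A\<^sup>2 = of_real (2 * B) * A + of_real (1728 * (u - y) ^ 3)" by simp
  moreover have "2 * B = 108 * sqrt (2 * u) * norm x" by (simp add: B_def)
  ultimately show ?thesis unfolding A_def by simp
qed

lemma cardano_A_eq_0_D:
  assumes "u > 0" "cardano_A u x y = 0"
  shows "x = 0" "y = u"
proof -
  have "Re (cardano_A u x y) = 0" using assms by simp
  then have "54 * sqrt (2 * u) * norm x + 6 * Re (csqrt (of_real (162 * (norm x)\<^sup>2 * u - 48 * y ^ 3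
      + 144 * y\<^sup>2 * u - 144 * y * u\<^sup>2 + 48 * u ^ 3))) = 0"
    unfolding cardano_A_def by (simp only: plus_complex.sel Re_complex_of_real) (simp del: csqrt.simps)
  moreover have "0 \<le> 54 * sqrt (2 * u) * norm x" using assms by simp
  ultimately have "54 * sqrt (2 * u) * norm x = 0" using Re_csqrt by (smt (verit))
  then show "x = 0" using assms by simp
  have "complex_of_real (1728 * (u - y) ^ 3) = 0"
    using cardano_A_square[OF assms(1), of x y] assms(2) by simp
  then show "y = u" unfolding of_real_eq_0_iff by simp
qed

lemma alpha_complex_cubic:
  assumes "u > 0"
  shows "alpha_complex u x y ^ 3 + of_real (- 2 * u * y + 2 * u\<^sup>2) * alpha_complex u x y
           - of_real (2 * u\<^sup>2 * norm x) = 0"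
proof (cases "cardano_A u x y = 0")
  case True
  then show ?thesis using cardano_A_eq_0_D[OF assms True] by (simp add: alpha_complex_def)
next
  case False
  define A s where "A = cardano_A u x y" and "s = A powr (1 / 3)"
  define c d m U where "c = complex_of_real (sqrt (2 * u))" and "d = complex_of_real (u - y)"
    and "m = complex_of_real (norm x)" and "U = complex_of_real u"
  have s0: "s \<noteq> 0" using False by (simp add: s_def A_def)
  have s3: "s ^ 3 = A"
    using False by (simp add: s_def A_def powr_def flip: exp_of_nat_mult)
  have sm: "A powr (- 1 / 3) = inverse s" by (simp add: s_def powr_minus)
  have c2: "c\<^sup>2 = 2 * U" using assms by (simp add: c_def U_def flip: of_real_power)
  have c0: "c \<noteq> 0" using assms by (simp add: c_def)
  have sq: "A\<^sup>2 = 108 * c * m * A + 1728 * d ^ 3"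
    using cardano_A_square[OF assms, of x y] by (simp add: A_def c_def d_def m_def)
  define t where "t = c * s / 6 - 2 * c * d * inverse s"
  have t: "alpha_complex u x y = t"
    unfolding alpha_complex_def A_def[symmetric] sm s_def[symmetric]
    by (simp add: t_def c_def d_def algebra_simps)
  have "t ^ 3 + c\<^sup>2 * d * t = c ^ 3 * (A / 216 - 8 * d ^ 3 / A)"
    unfolding t_def s3[symmetric] using s0
    by (simp add: field_simps power2_eq_square power3_eq_cube)
  also have "A / 216 - 8 * d ^ 3 / A = (A\<^sup>2 - 1728 * d ^ 3) / (216 * A)"
    using False by (simp add: A_def field_simps power2_eq_square)
  also have "\<dots> = c * m / 2" using False unfolding sq by (simp add: A_def)
  also have "c ^ 3 * (c * m / 2) = (c\<^sup>2)\<^sup>2 * m / 2" by (simp add: power2_eq_square power3_eq_cube)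
  also have "\<dots> = 2 * U\<^sup>2 * m" unfolding c2 by (simp add: power2_eq_square)
  finally have "t ^ 3 + 2 * U * d * t = 2 * U\<^sup>2 * m" unfolding c2 .
  then show ?thesis
    unfolding t by (simp add: U_def d_def m_def algebra_simps power2_eq_square)
qed

lemma of_real_alpha:
  assumes "u > 0"
  shows "of_real (alpha u x y) = alpha_complex u x y"
proof -
  define A where "A = cardano_A u x y"
  define D where "D = 162 * (norm x)\<^sup>2 * u - 48 * y ^ 3 + 144 * y\<^sup>2 * u - 144 * y * u\<^sup>2 + 48 * u ^ 3"
  have A: "A = of_real (54 * sqrt (2 * u) * norm x) + 6 * csqrt (of_real D)"
    by (simp add: A_def D_def cardano_A_def)
  have "alpha_complex u x y \<in> \<real>"
  proof (cases "D \<ge> 0")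
    case True
    define a where "a = 54 * sqrt (2 * u) * norm x + 6 * sqrt D"
    have Aa: "A = of_real a" using True by (simp add: A a_def csqrt_of_real_nonneg)
    have a0: "a \<ge> 0" using True assms by (simp add: a_def)
    have "A powr (1 / 3) = of_real (a powr (1 / 3))" "A powr (- 1 / 3) = of_real (a powr (- 1 / 3))"
      using a0 powr_of_real[of a "1/3"] powr_of_real[of a "-1/3"] by (simp_all add: Aa)
    then show ?thesis
      unfolding alpha_complex_def A_def[symmetric] by (metis Reals_add Reals_mult Reals_of_real)
  next
    case False
    define s where "s = A powr (1 / 3)"
    have A': "A = Complex (54 * sqrt (2 * u) * norm x) (6 * sqrt (- D))"
      using False by (simp add: A csqrt_of_real_nonpos complex_eq_iff)
    have A0: "A \<noteq> 0" using False by (simp add: A' complex_eq_iff)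
    have s0: "s \<noteq> 0" using A0 by (simp add: s_def)
    have "(norm A)\<^sup>2 = 1728 * (y - u) ^ 3"
      using False assms
      by (simp add: A' cmod_power2 power_mult_distrib)
         (simp add: D_def power2_eq_square power3_eq_cube algebra_simps)
    moreover have "norm A = norm s ^ 3"
    proof -
      have "s ^ 3 = A" using A0 by (simp add: s_def powr_def flip: exp_of_nat_mult)
      then show ?thesis by (metis norm_power)
    qed
    ultimately have "((norm s)\<^sup>2) ^ 3 = (12 * (y - u)) ^ 3"
      unfolding power_mult_distrib by (simp flip: power_mult)
    then have ns: "(norm s)\<^sup>2 = 12 * (y - u)"
      using power_eq_iff_eq_base odd_real_root_power_cancel[of 3] by (metis odd_numeral)
    have "A powr (- 1 / 3) = inverse s" by (simp add: s_def powr_minus)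
    also have "\<dots> = cnj s / of_real ((norm s)\<^sup>2)"
      using s0 by (simp add: field_simps complex_norm_square[symmetric] complex_mult_cnj)
    finally have i: "A powr (- 1 / 3) = cnj s / of_real (12 * (y - u))" unfolding ns .
    have yu: "y - u \<noteq> 0" using ns s0 by auto
    have "alpha_complex u x y = of_real (sqrt (2 * u) / 6) * (s + cnj s)"
      unfolding alpha_complex_def A_def[symmetric] i s_def[symmetric] using yu
      by (simp add: complex_eq_iff field_simps)
    then show ?thesis by (simp only: complex_add_cnj Reals_mult Reals_of_real)
  qed
  then show ?thesis by (simp add: alpha_def of_real_Re)
qed

end

theory Submission
  imports Defs
begin

text \<open>
  Everything rests on the variational characterization of projections: \<open>q\<close> is the point of a closed
  convex set \<open>S\<close> nearest to \<open>w\<close> iff \<open>(w - q) \<bullet> (v - q) \<le> 0\<close> for all \<open>v\<close> in \<open>S\<close>.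

  At a point of the slice \<open>z = u\<close>, a normal vector of the capped cone is a normal vector of the
  uncapped cone plus a nonnegative multiple of the \<open>z\<close>-axis. At the boundary point
  \<open>q = (x', y', u)\<close> with \<open>y' = \<parallel>x'\<parallel>\<^sup>2 / (2u)\<close> the uncapped cone has the normal vectors
  \<open>k (x', -u, -y')\<close>, \<open>k \<ge> 0\<close>, so \<open>q\<close> is the projection of \<open>(x, y, z)\<close> as soon as
  \<open>x = (1 + k) x'\<close>, \<open>y = y' - k u\<close> and \<open>z \<ge> u - k y'\<close>. Eliminating \<open>k\<close> and taking norms turns the
  first two equations into the cubic for \<open>t = \<parallel>x'\<parallel>\<close>, which has just one positive root if
  \<open>x \<noteq> 0\<close>. Cardano's expression with principal powers is positive (\<open>alpha_pos\<close>), so it is that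
  root, and \<open>x_tilde\<close> solves the two equations (\<open>x_tilde_stationary\<close>). The conditions of the second
  case then say \<open>k \<ge> 0\<close> and \<open>z \<ge> u - k y'\<close>. The first case is the one in which only the cap
  can be active.

  In the last case it suffices that the projection \<open>p\<close> onto the uncapped cone satisfies the cap: the
  involutive isometry \<open>rot_matrix\<close> exchanges that cone with the second-order cone, which gives the
  formula for \<open>p\<close>. Suppose that \<open>p\<close> lies above the cap. Some point \<open>w'\<close> differing from \<open>w\<close> only in
  its \<open>z\<close>-coordinate projects into the slice \<open>z = u\<close>: either \<open>w' = (x, y, u)\<close>, if this lies in the
  cone, or \<open>w' = (x, y, u - k y')\<close>. Since projections are monotone, \<open>w\<close> lies above \<open>w'\<close>
  (\<open>less_z_if_projection_above\<close>), and this is precisely what puts \<open>w\<close> into one of the first two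
  cases.
\<close>

section \<open>Variational inequalities\<close>

lemma closest_point_eqI:
  fixes S :: "'a::euclidean_space set"
  assumes "convex S" "closed S" "q \<in> S" "\<And>v. v \<in> S \<Longrightarrow> (w - q) \<bullet> (v - q) \<le> 0"
  shows "closest_point S w = q"
proof -
  have "dist w q \<le> dist w v" if "v \<in> S" for v
  proof -
    have "(w - v) \<bullet> (w - v) = (w - q) \<bullet> (w - q) - 2 * ((w - q) \<bullet> (v - q)) + (v - q) \<bullet> (v - q)"
      by (simp add: inner_diff_left inner_diff_right inner_commute)
    then have "(w - q) \<bullet> (w - q) \<le> (w - v) \<bullet> (w - v)"
      using assms(4)[OF that] inner_ge_zero[of "v - q"] by linarith
    then show ?thesis by (simp add: dist_norm norm_le)
  qed
  then show ?thesis
    using closest_point_unique[of S q w] assms by auto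
qed

lemma projections_firmly_nonexpansive:
  fixes p q w w' :: "'a::real_inner"
  assumes "(w - p) \<bullet> (q - p) \<le> 0" "(w' - q) \<bullet> (p - q) \<le> 0"
  shows "(p - q) \<bullet> (p - q) \<le> (w - w') \<bullet> (p - q)"
  using assms by (simp add: inner_diff_left inner_diff_right inner_commute)

section \<open>The positive root of the cubic\<close>

text \<open>
  A principal power multiplies the argument, at most \<open>\<pi>\<close> in absolute value, by the exponent; for
  small exponents the result stays in the right half-plane.
\<close>

lemma Re_powr_pos:
  assumes "z \<noteq> 0" "\<bar>r\<bar> < 1 / 2"
  shows "Re (z powr of_real r) > 0"
proof -
  have "\<bar>r * Im (Ln z)\<bar> \<le> \<bar>r\<bar> * pi"
    using Im_Ln_le_pi[OF assms(1)] mpi_less_Im_Ln[OF assms(1)]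
    by (simp add: abs_mult mult_left_mono)
  also have "\<dots> < pi / 2" using assms(2) by simp
  finally have "cos (r * Im (Ln z)) > 0" by (intro cos_gt_zero_pi) auto
  then show ?thesis using assms(1) by (simp add: powr_def Re_exp)
qed

lemma alpha_cubic:
  assumes "u > 0"
  shows "alpha u x y * ((alpha u x y)\<^sup>2 - 2 * u * y + 2 * u\<^sup>2) = 2 * u\<^sup>2 * norm x"
proof -
  have "complex_of_real (alpha u x y ^ 3 + (- 2 * u * y + 2 * u\<^sup>2) * alpha u x y
           - 2 * u\<^sup>2 * norm x) = 0"
    using alpha_complex_cubic[OF assms, of x y] of_real_alpha[OF assms, of x y] by simp
  then have "alpha u x y ^ 3 + (- 2 * u * y + 2 * u\<^sup>2) * alpha u x y - 2 * u\<^sup>2 * norm x = 0"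
    unfolding of_real_eq_0_iff .
  then show ?thesis by (simp add: power2_eq_square power3_eq_cube algebra_simps)
qed

text \<open>
  For \<open>y \<le> u\<close> the cubic \<open>t\<^sup>3 + 2u(u - y)t\<close> has the sign of \<open>t\<close>, and it must take the value
  \<open>2u\<^sup>2\<parallel>x\<parallel> > 0\<close>. For \<open>y > u\<close> there may be three real roots, and the choice of the branches matters: both summands of
  Cardano's formula have positive real part.
\<close>

lemma alpha_pos:
  assumes "u > 0" "x \<noteq> 0"
  shows "alpha u x y > 0"
proof (cases "y \<le> u")
  case True
  have "0 \<le> 2 * u * (u - y)" using True assms(1) by simp
  also have "\<dots> = 2 * u\<^sup>2 - 2 * u * y" by (simp add: power2_eq_square algebra_simps)
  finally have "(alpha u x y)\<^sup>2 - 2 * u * y + 2 * u\<^sup>2 \<ge> 0"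
    using zero_le_power2[of "alpha u x y"] by linarith
  moreover have "alpha u x y * ((alpha u x y)\<^sup>2 - 2 * u * y + 2 * u\<^sup>2) > 0"
    unfolding alpha_cubic[OF assms(1)] using assms by simp
  ultimately show ?thesis by (simp add: zero_less_mult_iff)
next
  case False
  have A: "cardano_A u x y \<noteq> 0" using cardano_A_eq_0_D assms by blast
  have p: "Re (cardano_A u x y powr (1 / 3)) > 0" "Re (cardano_A u x y powr (- 1 / 3)) > 0"
    using Re_powr_pos[OF A, of "1/3"] Re_powr_pos[OF A, of "-1/3"] by simp_all
  have "alpha u x y = sqrt (2 * u) / 6 * Re (cardano_A u x y powr (1 / 3))
      + sqrt (2 * u) * (- 2 * u + 2 * y) * Re (cardano_A u x y powr (- 1 / 3))"
    unfolding alpha_def alpha_complex_def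
    by (simp only: plus_complex.sel times_complex.sel Re_complex_of_real Im_complex_of_real)
  then show ?thesis using p assms False by (simp add: add_pos_pos)
qed

lemma x_tilde_eq:
  assumes "u > 0" "x \<noteq> 0"
  shows "x_tilde u x y = (alpha u x y / norm x) *\<^sub>R x"
proof -
  have "(alpha u x y)\<^sup>2 - 2 * u * y + 2 * u\<^sup>2 = 2 * u\<^sup>2 * norm x / alpha u x y"
    using alpha_cubic[OF assms(1), of x y] alpha_pos[OF assms, of y] by (simp add: field_simps)
  then show ?thesis
    using alpha_pos[OF assms, of y] assms by (simp add: x_tilde_def)
qed

lemma norm_x_tilde:
  assumes "u > 0" "x \<noteq> 0"
  shows "norm (x_tilde u x y) = alpha u x y"
  using alpha_pos[OF assms, of y] assms by (simp add: x_tilde_eq)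

text \<open>
  The \<open>x\<close>-component of the optimality condition in the slice \<open>z = u\<close>, where the factor
  \<open>k = (\<parallel>x'\<parallel>\<^sup>2 / (2u) - y) / u\<close> is the multiplier read off from the \<open>y\<close>-component.
\<close>

lemma x_tilde_stationary:
  assumes "u > 0"
  shows "x = (1 + ((norm (x_tilde u x y))\<^sup>2 / (2 * u) - y) / u) *\<^sub>R x_tilde u x y"
proof (cases "x = 0")
  case True
  then show ?thesis by (simp add: x_tilde_def)
next
  case False
  define a where "a = alpha u x y"
  have "1 + (a\<^sup>2 / (2 * u) - y) / u = (a\<^sup>2 - 2 * u * y + 2 * u\<^sup>2) / (2 * u\<^sup>2)"
    using assms by (simp add: field_simps power2_eq_square)
  moreover have "(a\<^sup>2 - 2 * u * y + 2 * u\<^sup>2) * a = 2 * u\<^sup>2 * norm x"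
    using alpha_cubic[OF assms, of x y] unfolding a_def by (simp add: mult.commute)
  ultimately have "(1 + (a\<^sup>2 / (2 * u) - y) / u) * (a / norm x) = 1"
    using assms False by simp
  moreover have "norm (x_tilde u x y) = a"
    using norm_x_tilde[OF assms False] by (simp add: a_def)
  moreover have "x_tilde u x y = (a / norm x) *\<^sub>R x"
    using x_tilde_eq[OF assms False] by (simp add: a_def)
  ultimately show ?thesis by (simp del: times_divide_eq_right)
qed

text \<open>
  The multiplier in \<open>x_tilde_stationary\<close> is nonnegative when \<open>(x, y)\<close> lies outside the interior of
  the paraboloid \<open>\<parallel>x\<parallel>\<^sup>2 \<le> 2uy\<close>. For \<open>x \<noteq> 0\<close>, otherwise
  the root \<open>a\<close> would satisfy \<open>a\<^sup>2 < 2uy \<le> \<parallel>x\<parallel>\<^sup>2\<close>, while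
  the cubic reads \<open>a (a\<^sup>2 - 2uy) = 2u\<^sup>2 (\<parallel>x\<parallel> - a)\<close>, whose sides would have opposite signs.
\<close>

lemma le_norm_x_tilde:
  assumes "u > 0" "2 * u * y \<le> (norm x)\<^sup>2"
  shows "y \<le> (norm (x_tilde u x y))\<^sup>2 / (2 * u)"
proof (cases "x = 0")
  case True
  then show ?thesis using assms by (simp add: x_tilde_def mult_le_0_iff)
next
  case False
  define a where "a = alpha u x y"
  have a: "a > 0" using alpha_pos[OF assms(1) False] by (simp add: a_def)
  show ?thesis
  proof (rule ccontr)
    assume "\<not> ?thesis"
    then have "a\<^sup>2 < 2 * u * y"
      using assms(1) norm_x_tilde[OF assms(1) False] by (simp add: a_def field_simps)
    then have "a\<^sup>2 < (norm x)\<^sup>2" and "a * (a\<^sup>2 - 2 * u * y) < 0"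
      using assms(2) a by (auto simp: mult_pos_neg)
    then have "a < norm x" by (simp add: power_less_imp_less_base)
    then have "2 * u\<^sup>2 * a < 2 * u\<^sup>2 * norm x" using assms(1) by simp
    also have "\<dots> = a * (a\<^sup>2 - 2 * u * y) + 2 * u\<^sup>2 * a"
      using alpha_cubic[OF assms(1), of x y] by (simp add: a_def algebra_simps)
    finally show False using \<open>a * (a\<^sup>2 - 2 * u * y) < 0\<close> by simp
  qed
qed

section \<open>The rotated cone in coordinates\<close>

lemma inner_split_xyz:
  fixes v w :: "real ^ 'n::{finite,linorder}"
  assumes "CARD('n) \<ge> 2"
  shows "v \<bullet> w = x_part v \<bullet> x_part w + v $ y_ix * w $ y_ix + v $ z_ix * w $ z_ix"
proof -
  have ne: "(y_ix :: 'n) \<noteq> z_ix" by (rule y_ix_neq_z_ix[OF assms])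
  have "v \<bullet> w = (\<Sum>i\<in>UNIV. x_part v $ i * x_part w $ i
      + (if i = y_ix then v $ y_ix * w $ y_ix else 0) + (if i = z_ix then v $ z_ix * w $ z_ix else 0))"
    unfolding inner_vec_def by (intro sum.cong) (use ne in \<open>auto simp: x_part_def\<close>)
  then show ?thesis by (simp add: sum.distrib inner_vec_def)
qed

lemma vec_eq_xyz_iff:
  "v = w \<longleftrightarrow> x_part v = x_part w \<and> v $ y_ix = w $ y_ix \<and> v $ z_ix = w $ z_ix"
  by (simp add: vec_eq_iff x_part_def) metis

lemma x_part_x_part: "x_part (x_part w) = x_part w"
  by (simp add: vec_eq_iff x_part_def)

lemma triple_sel:
  fixes x :: "real ^ 'n::{finite,linorder}"
  assumes "CARD('n) \<ge> 2"
  shows "x_part (triple x y z) = x_part x" "triple x y z $ y_ix = y" "triple x y z $ z_ix = z"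
  using y_ix_neq_z_ix[OF assms] by (auto simp: triple_def x_part_def vec_eq_iff)

lemma rot_matrix_sel:
  fixes w :: "real ^ 'n::{finite,linorder}"
  assumes "CARD('n) \<ge> 2"
  shows "x_part (rot_matrix *v w) = x_part w"
    and "(rot_matrix *v w) $ y_ix = (w $ z_ix - w $ y_ix) / sqrt 2"
    and "(rot_matrix *v w) $ z_ix = (w $ y_ix + w $ z_ix) / sqrt 2"
proof -
  have ne: "(y_ix :: 'n) \<noteq> z_ix" "(z_ix :: 'n) \<noteq> y_ix" using y_ix_neq_z_ix[OF assms] by auto
  have "(\<Sum>j\<in>UNIV. rot_matrix $ i $ j * w $ j) = w $ i" if "i \<noteq> y_ix" "i \<noteq> z_ix" for i :: 'n
  proof -
    have "(\<Sum>j\<in>UNIV. rot_matrix $ i $ j * w $ j) = (\<Sum>j\<in>UNIV. if j = i then w $ i else 0)"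
      by (intro sum.cong) (use that in \<open>auto simp: rot_matrix_def\<close>)
    then show ?thesis by simp
  qed
  then show "x_part (rot_matrix *v w) = x_part w"
    by (simp add: vec_eq_iff x_part_def matrix_vector_mult_def)
  have "(rot_matrix *v w) $ y_ix = (\<Sum>j\<in>(UNIV :: 'n set). (if j = y_ix then - (w $ y_ix / sqrt 2) else 0)
      + (if j = z_ix then w $ z_ix / sqrt 2 else 0))"
    unfolding matrix_vector_mult_def vec_lambda_beta
    by (intro sum.cong) (use ne in \<open>auto simp: rot_matrix_def\<close>)
  then show "(rot_matrix *v w) $ y_ix = (w $ z_ix - w $ y_ix) / sqrt 2"
    by (simp add: sum.distrib diff_divide_distrib)
  have "(rot_matrix *v w) $ z_ix = (\<Sum>j\<in>(UNIV :: 'n set). (if j = y_ix then w $ y_ix / sqrt 2 else 0)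
      + (if j = z_ix then w $ z_ix / sqrt 2 else 0))"
    unfolding matrix_vector_mult_def vec_lambda_beta
    by (intro sum.cong) (use ne in \<open>auto simp: rot_matrix_def\<close>)
  then show "(rot_matrix *v w) $ z_ix = (w $ y_ix + w $ z_ix) / sqrt 2"
    by (simp add: sum.distrib add_divide_distrib)
qed

lemma rot_matrix_involution:
  fixes w :: "real ^ 'n::{finite,linorder}"
  assumes "CARD('n) \<ge> 2"
  shows "rot_matrix *v (rot_matrix *v w) = w"
  unfolding vec_eq_xyz_iff[of _ w] rot_matrix_sel[OF assms]
  by (simp add: field_simps flip: add_divide_distrib diff_divide_distrib)

lemma rot_matrix_inner:
  fixes v w :: "real ^ 'n::{finite,linorder}"
  assumes "CARD('n) \<ge> 2"
  shows "(rot_matrix *v v) \<bullet> (rot_matrix *v w) = v \<bullet> w"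
  unfolding inner_split_xyz[OF assms, of v] inner_split_xyz[OF assms, of "rot_matrix *v v"] rot_matrix_sel[OF assms]
  by (simp add: field_simps)

text \<open>
  In the coordinates \<open>(z - y) / \<surd>2\<close> and \<open>(y + z) / \<surd>2\<close> the product \<open>2yz\<close> is a difference of two
  squares.
\<close>

lemma rot_matrix_soc_iff:
  fixes v :: "real ^ 'n::{finite,linorder}"
  assumes "CARD('n) \<ge> 2"
  shows "rot_matrix *v v \<in> soc \<longleftrightarrow> v \<in> rsoc"
proof -
  define x y z where "x = x_part v" and "y = v $ y_ix" and "z = v $ z_ix"
  let ?m = "rot_matrix *v v"
  have "(norm (init_part ?m))\<^sup>2 = ?m \<bullet> ?m - (?m $ z_ix)\<^sup>2"
    unfolding inner_split_last[of ?m] power2_norm_eq_inner by (simp add: power2_eq_square)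
  also have "\<dots> = x \<bullet> x + y * y + z * z - ((y + z) / sqrt 2)\<^sup>2"
    unfolding rot_matrix_inner[OF assms] inner_split_xyz[OF assms, of v] rot_matrix_sel[OF assms]
    by (simp add: x_def y_def z_def)
  also have "\<dots> = ((y + z) / sqrt 2)\<^sup>2 + ((norm x)\<^sup>2 - 2 * y * z)"
    unfolding power2_norm_eq_inner[of x] by (simp add: power_divide power2_eq_square field_simps)
  finally have sq: "(norm (init_part ?m))\<^sup>2 = ((y + z) / sqrt 2)\<^sup>2 + ((norm x)\<^sup>2 - 2 * y * z)" .
  have "?m \<in> soc \<longleftrightarrow> norm (init_part ?m) \<le> (y + z) / sqrt 2"
    by (simp add: soc_def rot_matrix_sel[OF assms] y_def z_def)
  also have "\<dots> \<longleftrightarrow> 0 \<le> (y + z) / sqrt 2 \<and> (norm (init_part ?m))\<^sup>2 \<le> ((y + z) / sqrt 2)\<^sup>2"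
    by (meson norm_ge_zero order_trans power2_le_imp_le power_mono)
  also have "\<dots> \<longleftrightarrow> 0 \<le> y + z \<and> (norm x)\<^sup>2 \<le> 2 * y * z"
    unfolding sq by (simp add: zero_le_divide_iff)
  also have "\<dots> \<longleftrightarrow> 0 \<le> y \<and> 0 \<le> z \<and> (norm x)\<^sup>2 \<le> 2 * y * z"
  proof -
    have "0 \<le> y \<and> 0 \<le> z" if "0 \<le> y + z" "(norm x)\<^sup>2 \<le> 2 * y * z"
    proof -
      have "0 \<le> y * z" using that(2) zero_le_power2[of "norm x"] by linarith
      then show ?thesis using that(1) by (auto simp: zero_le_mult_iff)
    qed
    then show ?thesis by auto
  qed
  finally show ?thesis by (simp add: rsoc_def x_def y_def z_def)
qed

lemma rotated_proj_soc_variational: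
  fixes w :: "real ^ 'n::{finite,linorder}"
  assumes "CARD('n) \<ge> 2"
  defines "p \<equiv> rot_matrix *v proj_soc (rot_matrix *v w)"
  shows "p \<in> rsoc" and "v \<in> rsoc \<Longrightarrow> (w - p) \<bullet> (v - p) \<le> 0"
proof -
  have "(0 :: (real, 'n) vec) \<in> soc" by (simp add: soc_def init_part_linear(3)[of 0, simplified])
  then have ne: "(soc :: (real, 'n) vec set) \<noteq> {}" by blast
  have Mp: "rot_matrix *v p = proj_soc (rot_matrix *v w)"
    by (simp add: p_def rot_matrix_involution[OF assms(1)])
  have "rot_matrix *v p \<in> soc"
    unfolding Mp proj_soc_eq_closest_point by (rule closest_point_in_set[OF closed_soc ne])
  then show "p \<in> rsoc" by (simp add: rot_matrix_soc_iff[OF assms(1)])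
  assume "v \<in> rsoc"
  then have "rot_matrix *v v \<in> soc" by (simp add: rot_matrix_soc_iff[OF assms(1)])
  then have "(rot_matrix *v w - rot_matrix *v p) \<bullet> (rot_matrix *v v - rot_matrix *v p) \<le> 0"
    unfolding Mp proj_soc_eq_closest_point by (rule closest_point_dot[OF convex_soc closed_soc])
  then show "(w - p) \<bullet> (v - p) \<le> 0"
    by (simp add: rot_matrix_inner[OF assms(1)] flip: matrix_vector_mult_diff_distrib)
qed

text \<open>
  The cone is self-dual up to a reflection: \<open>(x', -u, -y')\<close> has nonpositive inner product with
  all its elements whenever \<open>(x', y', u)\<close> belongs to it. This makes \<open>(x', -u, -y')\<close> an outer normal
  at \<open>(x', y', u)\<close> when that point is on the boundary.
\<close>

lemma rsoc_polar:
  fixes v x' :: "real ^ 'n::{finite,linorder}"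
  assumes "v \<in> rsoc" "0 \<le> y'" "0 \<le> u" "(norm x')\<^sup>2 \<le> 2 * y' * u"
  shows "x' \<bullet> x_part v \<le> u * v $ y_ix + y' * v $ z_ix"
proof -
  define p y z where "p = norm (x_part v)" and "y = v $ y_ix" and "z = v $ z_ix"
  have v: "0 \<le> y" "0 \<le> z" "p\<^sup>2 \<le> 2 * y * z" using assms(1) by (auto simp: rsoc_def p_def y_def z_def)
  have "(norm x' * p)\<^sup>2 \<le> (2 * y' * u) * (2 * y * z)"
    unfolding power_mult_distrib[of "norm x'"]
    by (rule mult_mono[OF assms(4) v(3)]) (use assms v in simp_all)
  also have "\<dots> \<le> (u * y + y' * z)\<^sup>2"
    using zero_le_power2[of "u * y - y' * z"] by (simp add: power2_eq_square algebra_simps)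
  finally have "norm x' * p \<le> u * y + y' * z"
    using v assms by - (rule power2_le_imp_le, simp_all add: add_nonneg_nonneg)
  then show ?thesis
    using norm_cauchy_schwarz[of x' "x_part v"] by (simp add: p_def y_def z_def)
qed

section \<open>The capped cone\<close>

text \<open>
  When the points \<open>w\<close> and \<open>w'\<close> differ only in the last coordinate, monotonicity of the projection
  reduces to an inequality between the last coordinates of the points and of their projections.
\<close>

lemma less_z_if_projection_above:
  fixes w w' p q :: "real ^ 'n::{finite,linorder}"
  assumes n: "CARD('n) \<ge> 2"
    and p: "\<And>v. v \<in> rsoc \<Longrightarrow> (w - p) \<bullet> (v - p) \<le> 0" "p \<in> rsoc"
    and q: "\<And>v. v \<in> rsoc \<Longrightarrow> (w' - q) \<bullet> (v - q) \<le> 0" "q \<in> rsoc"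
    and w': "x_part w' = x_part w" "w' $ y_ix = w $ y_ix"
    and above: "q $ z_ix < p $ z_ix"
  shows "w' $ z_ix < w $ z_ix"
proof -
  have "p - q \<noteq> 0" using above by auto
  then have "0 < (p - q) \<bullet> (p - q)" by simp
  also have "\<dots> \<le> (w - w') \<bullet> (p - q)"
    by (rule projections_firmly_nonexpansive) (use p q in auto)
  also have "\<dots> = (w $ z_ix - w' $ z_ix) * (p $ z_ix - q $ z_ix)"
    unfolding inner_split_xyz[OF n, of "w - w'"] by (simp add: x_part_linear w')
  finally show ?thesis using above by (simp add: zero_less_mult_iff)
qed

theorem theorem1:
  fixes w :: "real ^ 'n::{finite,linorder}" and u :: real
  assumes "CARD('n) \<ge> 2" and "u > 0"
  shows "closest_point (capped_rsoc u) w =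
    (let x = x_part w; y = w $ y_ix; z = w $ z_ix; x' = x_tilde u x y in
     if (norm x)\<^sup>2 < 2 * u * y \<and> u \<le> z then
       triple x y u
     else if z \<ge> u - (x' /\<^sub>R u) \<bullet> (x - x')
                   - (norm x')\<^sup>2 / (2 * u\<^sup>2) * (y - (norm x')\<^sup>2 / (2 * u))
             \<and> norm x' \<le> norm x \<and> y \<le> (norm x')\<^sup>2 / (2 * u) then
       triple x' ((norm x')\<^sup>2 / (2 * u)) u
     else
       rot_matrix *v proj_soc (rot_matrix *v w))"
proof -
  note n = assms(1) and u = assms(2)
  note sel = triple_sel[OF n]
  define x y z where "x = x_part w" and "y = w $ y_ix" and "z = w $ z_ix"
  define x' where "x' = x_tilde u x y"
  define y' where "y' = (norm x')\<^sup>2 / (2 * u)"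
  define k where "k = (y' - y) / u"
  define p where "p = rot_matrix *v proj_soc (rot_matrix *v w)"
  define q where "q = triple x' y' u"
  let ?c1 = "(norm x)\<^sup>2 < 2 * u * y \<and> u \<le> z"
  let ?c2 = "z \<ge> u - (x' /\<^sub>R u) \<bullet> (x - x') - (norm x')\<^sup>2 / (2 * u\<^sup>2) * (y - y')
             \<and> norm x' \<le> norm x \<and> y \<le> y'"
  have xx: "x_part x = x" by (simp add: x_def x_part_x_part)
  have xx': "x_part x' = x'" by (simp add: x'_def x_tilde_def x_part_linear xx)
  have y': "0 \<le> y'" "(norm x')\<^sup>2 = 2 * y' * u" using u by (simp_all add: y'_def)
  have yk: "y - y' = - (k * u)" using u by (simp add: k_def)
  have xk: "x = (1 + k) *\<^sub>R x'"
    unfolding k_def y'_def x'_def by (rule x_tilde_stationary[OF u])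
  then have xxk: "x - x' = k *\<^sub>R x'" by (simp add: algebra_simps)
  have q_rsoc: "q \<in> rsoc" using y' u by (simp add: q_def rsoc_def sel xx')
  (* (x, y, u - k y') is the point of the vertical line through w that projects onto q. *)
  have q_normal: "(triple x y (u - k * y') - q) \<bullet> (v - q) \<le> 0" if "v \<in> rsoc" "0 \<le> k" for v
  proof -
    have "(triple x y (u - k * y') - q) \<bullet> (v - q)
        = (x - x') \<bullet> (x_part v - x') + (y - y') * (v $ y_ix - y') - k * y' * (v $ z_ix - u)"
      unfolding inner_split_xyz[OF n, of "triple x y (u - k * y') - q"] by (simp add: x_part_linear q_def sel xx xx')
    also have "\<dots> = k * (x' \<bullet> x_part v - (u * v $ y_ix + y' * v $ z_ix))"
      unfolding xxk yk using y'(2)[unfolded power2_norm_eq_inner]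
      by (simp add: inner_diff_right algebra_simps)
    also have "\<dots> \<le> 0"
      using rsoc_polar[OF that(1) y'(1), of u x'] that(2) u y'(2)
      by (simp add: mult_nonneg_nonpos)
    finally show ?thesis .
  qed
  have c2: "?c2 \<longleftrightarrow> 0 \<le> k \<and> u - k * y' \<le> z"
  proof -
    have "(x' /\<^sub>R u) \<bullet> (x - x') = 2 * (k * y')"
      unfolding xxk using u y'(2)[unfolded power2_norm_eq_inner] by (simp add: field_simps)
    moreover have "(norm x')\<^sup>2 / (2 * u\<^sup>2) * (y - y') = - (k * y')"
      unfolding yk y'(2) using u by (simp add: power2_eq_square)
    moreover have "y \<le> y' \<longleftrightarrow> 0 \<le> k" using u by (simp add: k_def zero_le_divide_iff)
    moreover have "norm x' \<le> norm x" if "0 \<le> k"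
      using that by (simp add: xk mult_le_cancel_right1)
    ultimately show ?thesis by auto
  qed
  have cl: "closest_point (capped_rsoc u) w = r"
    if "r \<in> rsoc" "r $ z_ix \<le> u" "\<And>v. v \<in> capped_rsoc u \<Longrightarrow> (w - r) \<bullet> (v - r) \<le> 0" for r
    by (rule closest_point_eqI[OF convex_capped_rsoc closed_capped_rsoc])
       (use that in \<open>auto simp: capped_rsoc_def\<close>)
  have slice: "triple x y u \<in> rsoc" if "(norm x)\<^sup>2 < 2 * u * y"
  proof -
    have "0 < 2 * u * y" using that zero_le_power2[of "norm x"] by linarith
    then show ?thesis using u that by (simp add: rsoc_def sel xx zero_less_mult_iff mult_ac)
  qed
  have "closest_point (capped_rsoc u) w = (if ?c1 then triple x y u else if ?c2 then q else p)"
  proof (cases ?c1)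
    case c1: True
    have "closest_point (capped_rsoc u) w = triple x y u"
    proof (rule cl)
      fix v :: "(real, 'n) vec" assume "v \<in> capped_rsoc u"
      then have "v $ z_ix \<le> u" by (simp add: capped_rsoc_def)
      then have "(z - u) * (v $ z_ix - u) \<le> 0" using c1 by (simp add: mult_nonneg_nonpos)
      then show "(w - triple x y u) \<bullet> (v - triple x y u) \<le> 0"
        unfolding inner_split_xyz[OF n, of "w - triple x y u"] by (simp add: x_part_linear sel xx x_def[symmetric] y_def z_def)
    qed (use slice c1 in \<open>auto simp: sel\<close>)
    then show ?thesis unfolding if_P[OF c1] .
  next
    case c1: False
    show ?thesis
    proof (cases ?c2)
      case True
      then have k: "0 \<le> k" "u - k * y' \<le> z" unfolding c2 by auto
      have "closest_point (capped_rsoc u) w = q"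
      proof (rule cl)
        fix v :: "(real, 'n) vec" assume "v \<in> capped_rsoc u"
        then have v: "v \<in> rsoc" "v $ z_ix \<le> u" by (auto simp: capped_rsoc_def)
        have "(w - q) \<bullet> (v - q) = (triple x y (u - k * y') - q) \<bullet> (v - q)
            + (z - (u - k * y')) * (v $ z_ix - u)"
          unfolding inner_split_xyz[OF n, of "w - q"]
            inner_split_xyz[OF n, of "triple x y (u - k * y') - q"]
          by (simp add: x_part_linear q_def sel xx x_def[symmetric] y_def z_def algebra_simps)
        also have "\<dots> \<le> 0 + 0"
          using q_normal[OF v(1) k(1)] k(2) v(2) by (intro add_mono) (auto simp: mult_nonneg_nonpos)
        finally show "(w - q) \<bullet> (v - q) \<le> 0" by simp
      qed (use q_rsoc in \<open>auto simp: q_def sel\<close>)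
      then show ?thesis unfolding if_not_P[OF c1] if_P[OF True] .
    next
      case False
      note p = rotated_proj_soc_variational[OF n, where w = w, folded p_def]
      have "p $ z_ix \<le> u"
      proof (rule ccontr)
        assume above: "\<not> p $ z_ix \<le> u"
        (* Compare w with the point (x, y, u) or (x, y, u - k y'), whichever projects into the slice. *)
        show False
        proof (cases "(norm x)\<^sup>2 < 2 * u * y")
          case True
          have "triple x y u $ z_ix < w $ z_ix"
            by (rule less_z_if_projection_above[OF n p(2) p(1) _ slice[OF True]])
               (use above in \<open>auto simp: sel xx x_def[symmetric] y_def\<close>)
          then show False using True c1 by (simp add: sel z_def)
        next
          case nin: False
          then have "y \<le> y'" unfolding y'_def x'_def by (intro le_norm_x_tilde[OF u]) simp
          then have k: "0 \<le> k" using u by (simp add: k_def)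
          have "triple x y (u - k * y') $ z_ix < w $ z_ix"
            by (rule less_z_if_projection_above[OF n p(2) p(1) q_normal[OF _ k] q_rsoc])
               (use above in \<open>auto simp: sel xx x_def[symmetric] y_def q_def\<close>)
          then show False using False k unfolding c2 by (simp add: sel z_def)
        qed
      qed
      then have "closest_point (capped_rsoc u) w = p"
        by (intro cl p) (auto simp: capped_rsoc_def)
      then show ?thesis unfolding if_not_P[OF c1] if_not_P[OF False] .
    qed
  qed
  then show ?thesis
    unfolding Let_def x_def[symmetric] y_def[symmetric] z_def[symmetric] x'_def[symmetric]
      y'_def[symmetric] q_def[symmetric] p_def[symmetric] .
qed

end
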